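(* Let $n\ge 1$ and let $U\in \mathbf{M}_n(\mathbb{C})$. Suppose that $Q\in\mathbf{M}_n(\mathbb{C})$ is unitary and $T\in\mathbf{M}_n(\mathbb{C})$ is upper triangular with $U=QTQ^{*}$ (a Schur factorization of $U$), and that $T_{jj}\neq 0$ for all $j$. Let $D$ be the diagonal unitary matrix with $$D_{jj}=\frac{1}{|T_{jj}|}T_{jj}\qquad (1\le j\le n).$$ Then $$\left\Vert U-QDQ^{*}\right\Vert \leq \left(\sqrt{2(n-1)}+1\right)\left\Vert U^{*}U-I\right\Vert ^{\frac{1}{2}}.$$
   Context: $\mathbf{M}_n(\mathbb{C})$ is the set of $n\times n$ complex matrices, $U^{*}$ is the conjugate transpose of $U$, $I$ is the identity matrix, and $\|A\|=\sup_{\mathbf{v}\ne 0}\|A\mathbf{v}\|_2/\|\mathbf{v}\|_2$ is the operator norm. *)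

theory Defs
  imports "HOL-Analysis.Analysis"
begin

definition conj_transpose :: "complex^'n^'m \<Rightarrow> complex^'m^'n" where
  "conj_transpose A = (\<chi> i j. cnj (A $ j $ i))"

definition unitary_matrix :: "complex^'n^'n \<Rightarrow> bool" where
  "unitary_matrix Q \<longleftrightarrow>
    conj_transpose Q ** Q = mat 1 \<and> Q ** conj_transpose Q = mat 1"

(* The linear order on the index type plays the role of 1 < ... < n. *)
definition upper_triangular_matrix :: "complex^'n::{finite,linorder}^'n::_ \<Rightarrow> bool" where
  "upper_triangular_matrix T \<longleftrightarrow> (\<forall>i j. j < i \<longrightarrow> T $ i $ j = 0)"

(* The norm on the type of matrices is the Frobenius norm; the operator norm is onorm of the
   induced map. The norm on complex^'n is the Euclidean one, and the supremum in onorm_def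
   also ranges over v = 0, which contributes 0 / 0 = 0. *)
definition matrix_opnorm :: "complex^'n^'m \<Rightarrow> real" where
  "matrix_opnorm A = onorm ((*v) A)"

definition diagonal_matrix :: "('n \<Rightarrow> complex) \<Rightarrow> complex^'n^'n" where
  "diagonal_matrix d = (\<chi> i j. if i = j then d i else 0)"

end

(* The map T is an approximate isometry: |T x|^2 and |x|^2 differ by at most delta |x|^2,
   where delta is the operator norm of U* U - I. An eigenvector for the eigenvalue T_jj gives
   | |T_jj|^2 - 1 | <= delta, and the basis vector e_j bounds the square of the j-th column by
   1 + delta. So the strictly upper part of each column has square at most 2 delta, and it
   vanishes in the first column; this gives sqrt (2 (n - 1) delta) by Cauchy-Schwarz. The
   diagonal part of T - D contributes max | |T_jj| - 1 | <= sqrt delta. *)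
theory Submission
  imports Defs
begin

lemma conj_transpose_mul_diff:
  fixes U :: "complex^'n^'m"
  shows "((conj_transpose U ** U - mat 1) *v x) = conj_transpose U *v (U *v x) - x"
  by (simp add: matrix_vector_mult_diff_rdistrib matrix_vector_mul_assoc)

text \<open>\<open>inner\<close> on complex vectors is the real part of the Hermitian product, so
  the adjoint identity reduces entry by entry to moving a factor \<open>a\<close> across as
  \<open>cnj a\<close>.\<close>

lemma inner_conj_transpose:
  fixes A :: "complex^'n^'m"
  shows "inner (conj_transpose A *v y) x = inner y (A *v x)"
proof -
  have a: "inner (cnj a * b) c = inner b (a * c)" for a b c :: complex
    by (simp add: inner_complex_def algebra_simps)
  have "inner (conj_transpose A *v y) x = (\<Sum>i\<in>UNIV. \<Sum>j\<in>UNIV. inner (y $ j) (A $ j $ i * x $ i))"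
    by (simp add: inner_vec_def matrix_vector_mult_def conj_transpose_def inner_sum_left a)
  also have "\<dots> = inner y (A *v x)"
    by (subst sum.swap) (simp add: inner_vec_def matrix_vector_mult_def inner_sum_right)
  finally show ?thesis .
qed

lemma norm_isometry:
  fixes Q :: "complex^'n^'m"
  assumes "conj_transpose Q ** Q = mat 1"
  shows "norm (Q *v x) = norm x"
proof -
  have "inner (Q *v x) (Q *v x) = inner (conj_transpose Q *v (Q *v x)) x"
    by (simp add: inner_conj_transpose)
  then show ?thesis
    by (simp add: matrix_vector_mul_assoc assms norm_eq_sqrt_inner)
qed

text \<open>The difference of squares is the quadratic form of U* U - I at \<open>x\<close>, which
  Cauchy-Schwarz bounds by the operator norm.\<close>

lemma norm_square_defect_le:
  fixes U :: "complex^'n^'m"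
  shows "\<bar>(norm (U *v x))\<^sup>2 - (norm x)\<^sup>2\<bar>
    \<le> matrix_opnorm (conj_transpose U ** U - mat 1) * (norm x)\<^sup>2"
proof -
  let ?E = "conj_transpose U ** U - mat 1"
  have "(norm (U *v x))\<^sup>2 - (norm x)\<^sup>2 = inner (?E *v x) x"
    by (simp add: conj_transpose_mul_diff inner_diff_left inner_conj_transpose power2_norm_eq_inner)
  also have "\<bar>\<dots>\<bar> \<le> norm (?E *v x) * norm x"
    by (rule Cauchy_Schwarz_ineq2)
  also have "\<dots> \<le> (onorm ((*v) ?E) * norm x) * norm x"
    by (intro mult_right_mono onorm matrix_vector_mul_bounded_linear) simp
  finally show ?thesis
    by (simp add: matrix_opnorm_def power2_eq_square mult.assoc)
qed

text \<open>A dimension count replaces determinants: \<open>B\<close> maps the span of the basis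
  vectors up to \<open>j\<close> into the span of those strictly before \<open>j\<close>, so it
  cannot be injective.\<close>

lemma upper_triangular_zero_diag_kernel:
  fixes B :: "complex^'n::{finite,linorder}^'n::_"
  assumes B: "upper_triangular_matrix B" and j: "B $ j $ j = 0"
  shows "\<exists>v. v \<noteq> 0 \<and> B *v v = 0"
proof (rule ccontr)
  assume "\<not> ?thesis"
  then have inj: "inj ((*v) B)"
    by (auto simp: inj_on_def matrix_vector_mult_diff_distrib[symmetric])
      (metis eq_iff_diff_eq_0 matrix_vector_mult_diff_distrib)
  let ?e = "\<lambda>i::'n. axis i (1::complex)"
  have inje: "inj_on ?e A" for A by (auto simp: inj_on_def axis_eq_axis)
  have indep: "vec.independent (?e ` {..j})"
    by (rule vec.independent_mono[OF independent_cart_basis]) (auto simp: cart_basis_def)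
  have "vec.independent ((*v) B ` (?e ` {..j}))"
    by (rule vec.independent_inj_image[OF indep inj])
  moreover have "(*v) B ` (?e ` {..j}) \<subseteq> vec.span (?e ` {..<j})"
  proof safe
    fix i assume i: "i \<le> j"
    \<comment> \<open>Here \<open>k\<close> is at least \<open>j\<close> and \<open>i\<close> at
      most \<open>j\<close>. Either \<open>k = i = j\<close>, where the diagonal entry vanishes, or
      \<open>i < k\<close>, where triangularity applies.\<close>
    have z: "B $ k $ i = 0" if "\<not> k < j" for k
      using that i j B unfolding upper_triangular_matrix_def
      by (cases "k = i") auto
    have "B *v ?e i = (\<Sum>k\<in>UNIV. B $ k $ i *s ?e k)"
      by (simp add: vec_eq_iff matrix_vector_mult_def axis_def if_distrib cong: if_cong)
    also have "\<dots> = (\<Sum>k\<in>{..<j}. B $ k $ i *s ?e k)"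
      by (rule sum.mono_neutral_right) (auto simp: z)
    also have "\<dots> \<in> vec.span (?e ` {..<j})"
      by (intro vec.span_sum vec.span_scale vec.span_base) auto
    finally show "B *v ?e i \<in> vec.span (?e ` {..<j})" .
  qed
  ultimately have "card ((*v) B ` (?e ` {..j})) \<le> card (?e ` {..<j})"
    by (intro conjunct2[OF vec.independent_span_bound]) auto
  moreover have "card ((*v) B ` (?e ` {..j})) = card {..j}"
    by (simp add: card_image inj_on_subset[OF inj] inje)
  moreover have "card (?e ` {..<j}) = card {..<j}"
    by (simp add: card_image inje)
  moreover have "card {..<j} < card {..j}"
    by (rule psubset_card_mono) auto
  ultimately show False by simp
qed

text \<open>Subtracting the scalar matrix of \<open>T $ j $ j\<close> keeps \<open>T\<close> upper
  triangular and puts a zero at diagonal position \<open>j\<close>; a kernel vector of the result is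
  the eigenvector.\<close>

lemma upper_triangular_eigenvector:
  fixes T :: "complex^'n::{finite,linorder}^'n::_"
  assumes "upper_triangular_matrix T"
  obtains v where "v \<noteq> 0" "T *v v = T $ j $ j *s v"
proof -
  have "upper_triangular_matrix (T - mat (T $ j $ j))"
    using assms by (auto simp: upper_triangular_matrix_def mat_def)
  moreover have "(T - mat (T $ j $ j)) $ j $ j = 0"
    by (simp add: mat_def)
  ultimately obtain v where v: "v \<noteq> 0" "(T - mat (T $ j $ j)) *v v = 0"
    using upper_triangular_zero_diag_kernel by blast
  have "mat (T $ j $ j) *v v = T $ j $ j *s v"
    by (simp add: vec_eq_iff matrix_vector_mult_def mat_def if_distribR if_distrib cong: if_cong)
  with v that show ?thesis
    by (simp add: matrix_vector_mult_diff_rdistrib)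
qed

lemma norm_vector_smult_complex:
  "norm (c *s (v :: complex^'n)) = cmod c * norm v"
  by (simp add: norm_vec_def L2_set_def norm_mult power_mult_distrib real_sqrt_mult
      flip: sum_distrib_left)

lemma norm_diagonal_mult_le:
  assumes "\<And>i. cmod (d i) \<le> c"
  shows "norm (diagonal_matrix d *v x) \<le> c * norm x"
proof -
  have c: "0 \<le> c" using order_trans[OF norm_ge_zero assms] .
  have "diagonal_matrix d *v x = (\<chi> i. d i * x $ i)"
    by (simp add: vec_eq_iff matrix_vector_mult_def diagonal_matrix_def if_distribR if_distrib cong: if_cong)
  then have "norm (diagonal_matrix d *v x) = L2_set (\<lambda>i. cmod (d i) * cmod (x $ i)) UNIV"
    by (simp add: norm_vec_def norm_mult)
  also have "\<dots> \<le> L2_set (\<lambda>i. c * cmod (x $ i)) UNIV"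
    by (intro L2_set_mono mult_right_mono assms) auto
  also have "\<dots> = c * norm x"
    using c by (simp add: norm_vec_def L2_set_right_distrib)
  finally show ?thesis .
qed

text \<open>Expand the product over the columns and apply Cauchy-Schwarz. Only columns in
  \<open>J\<close> are counted, so a known zero column improves the factor from n to n - 1 under the
  root.\<close>

lemma norm_matrix_vector_mult_column_le:
  fixes N :: "complex^'n^'m"
  assumes c: "0 \<le> c" and "\<And>j. norm (column j N) \<le> c" and "\<And>j. j \<notin> J \<Longrightarrow> column j N = 0"
  shows "norm (N *v x) \<le> sqrt (real (card J)) * c * norm x"
proof -
  have "N *v x = (\<Sum>j\<in>UNIV. x $ j *s column j N)"
    by (rule matrix_mult_sum)
  also have "\<dots> = (\<Sum>j\<in>J. x $ j *s column j N)"
    by (rule sum.mono_neutral_right) (auto simp: assms(3))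
  also have "norm \<dots> \<le> (\<Sum>j\<in>J. cmod (x $ j) * c)"
    by (intro sum_norm_le) (simp add: norm_vector_smult_complex mult_left_mono assms(2))
  also have "\<dots> = (\<Sum>j\<in>J. \<bar>cmod (x $ j)\<bar> * \<bar>c\<bar>)"
    using c by simp
  also have "\<dots> \<le> L2_set (\<lambda>j. cmod (x $ j)) J * L2_set (\<lambda>j. c) J"
    by (rule L2_set_mult_ineq)
  also have "\<dots> \<le> norm x * L2_set (\<lambda>j. c) J"
    unfolding norm_vec_def
    by (intro mult_right_mono L2_set_nonneg) (auto simp: L2_set_def intro!: sum_mono2)
  also have "L2_set (\<lambda>j. c) J = sqrt (real (card J)) * c"
    using c by (simp add: L2_set_def real_sqrt_mult)
  finally show ?thesis by (simp add: mult_ac)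
qed

text \<open>For nonnegative \<open>t\<close>, \<open>\<bar>t - 1\<bar>\<close> is at most
  \<open>t + 1\<close>, so its square is at most \<open>\<bar>t\<^sup>2 - 1\<bar>\<close>.\<close>

lemma abs_diff_one_le_sqrt:
  fixes t d :: real
  assumes "0 \<le> t" and "\<bar>t\<^sup>2 - 1\<bar> \<le> d"
  shows "\<bar>t - 1\<bar> \<le> sqrt d"
proof (rule real_le_rsqrt)
  have "\<bar>t - 1\<bar>\<^sup>2 \<le> \<bar>t - 1\<bar> * \<bar>t + 1\<bar>"
    unfolding power2_eq_square using assms(1) by (intro mult_left_mono) auto
  also have "\<dots> = \<bar>t\<^sup>2 - 1\<bar>"
    by (simp add: power2_eq_square algebra_simps flip: abs_mult)
  finally show "\<bar>t - 1\<bar>\<^sup>2 \<le> d" using assms(2) by simp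
qed

theorem theorem6:
  fixes U Q T D :: "complex^'n::{finite,linorder}^'n::_"
  assumes "unitary_matrix Q"
    and "upper_triangular_matrix T"
    and "U = Q ** T ** conj_transpose Q"
    and "\<And>j. T $ j $ j \<noteq> 0"
    and "D = diagonal_matrix (\<lambda>j. 1 / of_real (cmod (T $ j $ j)) * T $ j $ j)"
  shows "matrix_opnorm (U - Q ** D ** conj_transpose Q)
    \<le> (sqrt (2 * (real CARD('n) - 1)) + 1)
        * matrix_opnorm (conj_transpose U ** U - mat 1) powr (1/2)"
proof -
  define \<delta> where "\<delta> = matrix_opnorm (conj_transpose U ** U - mat 1)"
  have \<delta>: "0 \<le> \<delta>"
    by (simp add: \<delta>_def matrix_opnorm_def onorm_pos_le matrix_vector_mul_bounded_linear)
  have Q: "conj_transpose Q ** Q = mat 1" "Q ** conj_transpose Q = mat 1"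
    using assms(1) by (auto simp: unitary_matrix_def)
  have normQ: "norm (Q *v x) = norm x" for x
    by (rule norm_isometry[OF Q(1)])
  have normQ': "norm (conj_transpose Q *v x) = norm x" for x
    using normQ[of "conj_transpose Q *v x"] by (simp add: matrix_vector_mul_assoc Q)
  \<comment> \<open>\<open>T\<close> inherits the defect of \<open>U\<close> with the same constant,
    since U Q = Q T and \<open>Q\<close> preserves norms.\<close>
  have T_defect: "\<bar>(norm (T *v x))\<^sup>2 - (norm x)\<^sup>2\<bar> \<le> \<delta> * (norm x)\<^sup>2" for x
  proof -
    have "U *v (Q *v x) = Q *v (T *v x)"
      by (simp add: assms(3) matrix_vector_mul_assoc matrix_mul_assoc[symmetric] Q)
    then show ?thesis
      using norm_square_defect_le[of U "Q *v x"] by (simp add: normQ \<delta>_def)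
  qed
  have diag: "\<bar>(cmod (T $ j $ j))\<^sup>2 - 1\<bar> \<le> \<delta>" for j
  proof -
    obtain v where v: "v \<noteq> 0" "T *v v = T $ j $ j *s v"
      using upper_triangular_eigenvector[OF assms(2)] .
    have "(norm (T *v v))\<^sup>2 - (norm v)\<^sup>2 = ((cmod (T $ j $ j))\<^sup>2 - 1) * (norm v)\<^sup>2"
      by (simp add: v(2) norm_vector_smult_complex power_mult_distrib algebra_simps)
    then have "\<bar>(cmod (T $ j $ j))\<^sup>2 - 1\<bar> * (norm v)\<^sup>2 \<le> \<delta> * (norm v)\<^sup>2"
      using T_defect[of v] by (simp add: abs_mult)
    then show ?thesis using v(1) by simp
  qed
  define N where "N = (\<chi> i j. if i = j then 0 else T $ i $ j)"
  define d where "d j = T $ j $ j - 1 / of_real (cmod (T $ j $ j)) * T $ j $ j" for j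
  have TD: "T - D = N + diagonal_matrix d"
    by (auto simp: vec_eq_iff N_def d_def diagonal_matrix_def assms(5))
  have col: "norm (column j N) \<le> sqrt (2 * \<delta>)" for j
  proof (rule real_le_rsqrt)
    have "T *v axis j 1 = column j T"
      by (simp add: vec_eq_iff matrix_vector_mult_def axis_def column_def if_distrib cong: if_cong)
    then have "(norm (column j T))\<^sup>2 \<le> 1 + \<delta>"
      using T_defect[of "axis j 1"] by simp
    \<comment> \<open>Pythagoras splits off the diagonal entry. As its square is at least 1 -
      \<delta> and the whole column has square at most 1 + \<delta>, the remainder is at most 2
      \<delta>.\<close>
    moreover have "(norm (column j T))\<^sup>2 = (cmod (T $ j $ j))\<^sup>2 + (norm (column j N))\<^sup>2"
    proof -
      have "(\<Sum>i\<in>UNIV - {j}. (cmod (T $ i $ j))\<^sup>2) = (\<Sum>i\<in>UNIV - {j}. (cmod (N $ i $ j))\<^sup>2)"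
        by (rule sum.cong) (auto simp: N_def)
      moreover have "N $ j $ j = 0" by (simp add: N_def)
      ultimately show ?thesis
        by (simp add: norm_vec_def L2_set_def column_def sum_nonneg sum.remove[of UNIV j])
    qed
    ultimately show "(norm (column j N))\<^sup>2 \<le> 2 * \<delta>"
      using diag[of j] by linarith
  qed
  \<comment> \<open>The least index plays the role of 1: nothing lies above the diagonal in its
    column, so that column of \<open>N\<close> is zero.\<close>
  define m where "m = Min (UNIV :: 'n set)"
  have "column m N = 0"
  proof -
    have "N $ i $ m = 0" for i
      using assms(2) Min_le[of UNIV i] unfolding m_def[symmetric] upper_triangular_matrix_def
      by (auto simp: N_def)
    then show ?thesis by (simp add: vec_eq_iff column_def)
  qed
  then have "norm (N *v x) \<le> sqrt (real (card (UNIV - {m}))) * sqrt (2 * \<delta>) * norm x" for x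
    by (intro norm_matrix_vector_mult_column_le col) (auto simp: \<delta>)
  moreover have "real (card (UNIV - {m})) = real CARD('n) - 1"
    by (simp add: card_Diff_singleton of_nat_diff Suc_le_eq)
  ultimately have N: "norm (N *v x) \<le> sqrt (2 * (real CARD('n) - 1)) * sqrt \<delta> * norm x" for x
    by (simp only: real_sqrt_mult mult_ac)
  have "cmod (d j) \<le> sqrt \<delta>" for j
  proof -
    \<comment> \<open>The entry and its normalization lie on the same ray from 0, so their
      difference is a real number times a factor of modulus 1.\<close>
    have "d j = of_real (cmod (T $ j $ j) - 1) * (T $ j $ j / of_real (cmod (T $ j $ j)))"
      using assms(4)[of j] by (simp add: d_def field_simps)
    then have "cmod (d j) = \<bar>cmod (T $ j $ j) - 1\<bar>"
      using assms(4)[of j] by (simp only: norm_mult norm_of_real norm_divide) simp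
    then show ?thesis
      using abs_diff_one_le_sqrt[OF _ diag] by simp
  qed
  then have d: "norm (diagonal_matrix d *v x) \<le> sqrt \<delta> * norm x" for x
    by (rule norm_diagonal_mult_le)
  have TD_le: "norm ((T - D) *v x) \<le> (sqrt (2 * (real CARD('n) - 1)) + 1) * sqrt \<delta> * norm x" for x
    using norm_triangle_ineq[of "N *v x" "diagonal_matrix d *v x"] N[of x] d[of x]
    by (simp add: TD matrix_vector_mult_add_rdistrib algebra_simps)
  have "matrix_opnorm (U - Q ** D ** conj_transpose Q)
      \<le> (sqrt (2 * (real CARD('n) - 1)) + 1) * sqrt \<delta>"
    unfolding matrix_opnorm_def
  proof (rule onorm_bound)
    \<comment> \<open>This rests on n being at least 1, as \<open>sqrt\<close> of a negative real is
      negative.\<close>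
    show "0 \<le> (sqrt (2 * (real CARD('n) - 1)) + 1) * sqrt \<delta>"
      using \<delta> by (simp add: Suc_le_eq)
    fix x
    \<comment> \<open>Conjugation by \<open>Q\<close> reduces the estimate to the one for
      \<open>T - D\<close>, because both outer factors preserve the norm.\<close>
    have "(U - Q ** D ** conj_transpose Q) *v x = Q *v ((T - D) *v (conj_transpose Q *v x))"
      by (simp add: assms(3) matrix_vector_mult_diff_rdistrib matrix_vector_mult_diff_distrib
          flip: matrix_vector_mul_assoc)
    then show "norm ((U - Q ** D ** conj_transpose Q) *v x)
        \<le> (sqrt (2 * (real CARD('n) - 1)) + 1) * sqrt \<delta> * norm x"
      using TD_le[of "conj_transpose Q *v x"] by (simp add: normQ normQ')
  qed
  then show ?thesis
    using \<delta> by (simp add: powr_half_sqrt \<delta>_def)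
qed

end
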